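(* Let $p$ be a prime and let $A,B$ be $\delta$-Cartier rings. Let $f:A\to B$ be a map of $\delta$-rings such that $f$ carries the ideal $V(A)\subset A$ into the ideal $V(B)\subset B$. If $p>2$, then $f$ is a map of $\delta$-Cartier rings, i.e. $f$ commutes with $V$. If $p=2$ and either $f(V(1))=V(1)$ or $B$ is $V$-adically separated (i.e. $\bigcap_{i\ge0}V^i(B)=0$), then $f$ is a map of $\delta$-Cartier rings.
   Context: All rings are commutative with unit. A $\delta$-ring is a ring $A$ with a map $\delta:A\to A$ such that $\delta(0)=\delta(1)=0$, $\delta(x+y)=\delta(x)+\delta(y)-\sum_{i=1}^{p-1}\frac1p\binom pi x^iy^{p-i}$ and $\delta(xy)=x^p\delta(y)+y^p\delta(x)+p\delta(x)\delta(y)$; its Frobenius is $F(a)=a^p+p\delta(a)$. A $\delta$-Cartier ring is a $\delta$-ring $A$ with an additive map $V:A\to A$ such that for all $a,b\in A$: (1) $F(V(a))=pa$; (2) $aV(b)=V(F(a)b)$; (3) $\delta(V(a))=a-p^{p-2}V(a^p)$. Morphisms are $\delta$-ring maps commuting with $V$. *)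

theory Defs
  imports "HOL-Algebra.RingHom" "HOL-Computational_Algebra.Primes"
begin

text \<open>
  Rings are carrier-based (HOL-Algebra's \<^locale>\<open>cring\<close>), so that the zero ring is allowed.
  Integers act on a ring through \<open>[n] \<cdot> x\<close>.  In the sum formula for \<open>\<delta>\<close>, the coefficient
  \<open>(p choose i) div p\<close> is an exact quotient, since \<open>p\<close> is prime and \<open>0 < i < p\<close>.
\<close>

locale delta_ring = cring R for p :: nat and R (structure) and \<delta> :: "'a \<Rightarrow> 'a" +
  assumes prime_p: "prime p"
    and delta_closed: "\<delta> \<in> carrier R \<rightarrow> carrier R"
    and delta_zero: "\<delta> \<zero> = \<zero>"
    and delta_one: "\<delta> \<one> = \<zero>"
    and delta_add: "\<lbrakk>x \<in> carrier R; y \<in> carrier R\<rbrakk> \<Longrightarrow>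
      \<delta> (x \<oplus> y) =
        (\<delta> x \<oplus> \<delta> y)
          \<ominus> (\<Oplus>i\<in>{1..p - 1}. [((p choose i) div p)] \<cdot> (x [^] i \<otimes> y [^] (p - i)))"
    and delta_mult: "\<lbrakk>x \<in> carrier R; y \<in> carrier R\<rbrakk> \<Longrightarrow>
      \<delta> (x \<otimes> y) =
        x [^] p \<otimes> \<delta> y \<oplus> y [^] p \<otimes> \<delta> x \<oplus> [p] \<cdot> (\<delta> x \<otimes> \<delta> y)"

definition delta_Frobenius ::
    "nat \<Rightarrow> ('a, 'm) ring_scheme \<Rightarrow> ('a \<Rightarrow> 'a) \<Rightarrow> 'a \<Rightarrow> 'a"
  where "delta_Frobenius p R \<delta> a = a [^]\<^bsub>R\<^esub> p \<oplus>\<^bsub>R\<^esub> [p] \<cdot>\<^bsub>R\<^esub> \<delta> a"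

locale delta_Cartier_ring = delta_ring p R \<delta>
  for p :: nat and R (structure) and \<delta> :: "'a \<Rightarrow> 'a" +
  fixes V :: "'a \<Rightarrow> 'a"
  assumes V_closed: "V \<in> carrier R \<rightarrow> carrier R"
    and V_add: "\<lbrakk>a \<in> carrier R; b \<in> carrier R\<rbrakk> \<Longrightarrow> V (a \<oplus> b) = V a \<oplus> V b"
    and Frobenius_V: "a \<in> carrier R \<Longrightarrow> delta_Frobenius p R \<delta> (V a) = [p] \<cdot> a"
    and mult_V: "\<lbrakk>a \<in> carrier R; b \<in> carrier R\<rbrakk> \<Longrightarrow>
      a \<otimes> V b = V (delta_Frobenius p R \<delta> a \<otimes> b)"
    and delta_V: "a \<in> carrier R \<Longrightarrow> \<delta> (V a) = a \<ominus> [(p ^ (p - 2))] \<cdot> V (a [^] p)"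

definition delta_ring_hom ::
    "('a, 'm) ring_scheme \<Rightarrow> ('a \<Rightarrow> 'a) \<Rightarrow> ('b, 'n) ring_scheme \<Rightarrow> ('b \<Rightarrow> 'b) \<Rightarrow> ('a \<Rightarrow> 'b) set"
  where "delta_ring_hom R \<delta>R S \<delta>S =
    {f \<in> ring_hom R S. \<forall>x\<in>carrier R. f (\<delta>R x) = \<delta>S (f x)}"

definition delta_Cartier_ring_hom ::
    "('a, 'm) ring_scheme \<Rightarrow> ('a \<Rightarrow> 'a) \<Rightarrow> ('a \<Rightarrow> 'a) \<Rightarrow>
     ('b, 'n) ring_scheme \<Rightarrow> ('b \<Rightarrow> 'b) \<Rightarrow> ('b \<Rightarrow> 'b) \<Rightarrow> ('a \<Rightarrow> 'b) set"
  where "delta_Cartier_ring_hom R \<delta>R VR S \<delta>S VS =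
    {f \<in> delta_ring_hom R \<delta>R S \<delta>S. \<forall>x\<in>carrier R. f (VR x) = VS (f x)}"

definition V_adically_separated :: "('a, 'm) ring_scheme \<Rightarrow> ('a \<Rightarrow> 'a) \<Rightarrow> bool"
  where "V_adically_separated R V \<longleftrightarrow> (\<Inter>i::nat. (V ^^ i) ` carrier R) = {\<zero>\<^bsub>R\<^esub>}"

end

theory Submission
  imports Defs "HOL-Algebra.Multiplicative_Group"
begin

text \<open>
  Write \<open>f (V a) = V (g a)\<close>, which is possible because \<open>f\<close> maps \<open>V(A)\<close> into \<open>V(B)\<close>.  The map \<open>V\<close>
  of a \<open>\<delta>\<close>-Cartier ring is injective (lemma \<open>V_inj\<close>), so \<open>g\<close> is a well-defined additive map with
  \<open>g (F a \<cdot> b) = F (f a) \<cdot> g b\<close>, and the theorem says that the defect \<open>e = g - f\<close> vanishes.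
  Applying \<open>F\<close> to \<open>f (V a) = V (g a)\<close> gives \<open>p e = 0\<close>; applying \<open>\<delta>\<close> gives
  \<open>e a = p^(p-2) V ((g a)^p - g (a^p))\<close>, where the argument of \<open>V\<close> is again killed by \<open>p\<close>.

  If \<open>p > 2\<close>, the factor \<open>p^(p-2)\<close> is divisible by \<open>p\<close>, hence \<open>e = 0\<close>.

  If \<open>p = 2\<close>, the factor is 1 and the equation reads \<open>e a = V x\<close> with \<open>2 x = 0\<close>.  Elements of this
  form square to zero, so \<open>(g a)^2 = (f a)^2\<close> and the equation becomes \<open>e a = V (e (a^2))\<close>;
  the sign is immaterial as \<open>2 e = 0\<close>.
  Because \<open>e\<close> kills multiples of 2, \<open>e (a^2) = e (F a) = F (f a) e 1\<close>, and the projection formula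
  turns this into \<open>e a = f a \<cdot> V (e 1)\<close>.  So everything is controlled by \<open>e 1\<close>, which is a fixed
  point of \<open>V\<close>: it vanishes if \<open>f (V 1) = V 1\<close>, and it lies in the intersection of all
  \<open>V^i(B)\<close>, hence vanishes if \<open>B\<close> is \<open>V\<close>-adically separated.
\<close>

section \<open>Torsion and powers in commutative rings\<close>

context cring
begin

lemma add_pow_minus:
  "\<lbrakk>x \<in> carrier R; y \<in> carrier R\<rbrakk> \<Longrightarrow> [(n::nat)] \<cdot> (x \<ominus> y) = [n] \<cdot> x \<ominus> [n] \<cdot> y"
  by (simp add: minus_eq add.nat_pow_distrib add.nat_pow_inv)

lemma add_pow_cong_nat_pow:
  assumes "x \<in> carrier R" "y \<in> carrier R" "[(n::nat)] \<cdot> x = [n] \<cdot> y"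
  shows "[n] \<cdot> (x [^] (k::nat)) = [n] \<cdot> (y [^] k)"
proof (induction k)
  case (Suc k)
  have "[n] \<cdot> (x [^] Suc k) = ([n] \<cdot> (x [^] k)) \<otimes> x"
    using assms by (simp add: add_pow_ldistr)
  also have "\<dots> = y [^] k \<otimes> ([n] \<cdot> x)"
    unfolding Suc using assms(1,2) by (simp add: add_pow_ldistr add_pow_rdistr)
  also have "\<dots> = [n] \<cdot> (y [^] Suc k)"
    using assms by (simp add: add_pow_rdistr)
  finally show ?case .
qed simp

lemma square_eq_if_diff_square_zero:
  assumes "x \<in> carrier R" "y \<in> carrier R"
    and "[(2::nat)] \<cdot> (x \<ominus> y) = \<zero>" "(x \<ominus> y) [^] (2::nat) = \<zero>"
  shows "x [^] (2::nat) = y [^] (2::nat)"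
proof -
  define d where "d = x \<ominus> y"
  have d: "d \<in> carrier R" using assms d_def by simp
  have x: "x = y \<oplus> d" unfolding d_def using assms(1,2) by algebra
  have two: "d \<oplus> d = \<zero>" using assms(3) d by (simp add: d_def numeral_2_eq_2)
  have sq: "d \<otimes> d = \<zero>" using assms(4) d by (simp add: d_def numeral_2_eq_2)
  have "x \<otimes> x = y \<otimes> y \<oplus> y \<otimes> (d \<oplus> d) \<oplus> d \<otimes> d"
    unfolding x using d assms(2) by algebra
  then have "x \<otimes> x = y \<otimes> y" using two sq assms(2) by simp
  then show ?thesis using assms(1,2) by (simp add: numeral_2_eq_2)
qed

end

section \<open>The Verschiebung of a delta-Cartier ring\<close>

context delta_ring
begin

lemma delta_in_carrier [simp]: "x \<in> carrier R \<Longrightarrow> \<delta> x \<in> carrier R"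
  using delta_closed by auto

lemma Frobenius_closed [simp]: "x \<in> carrier R \<Longrightarrow> delta_Frobenius p R \<delta> x \<in> carrier R"
  by (simp add: delta_Frobenius_def)

end

context delta_Cartier_ring
begin

lemma V_in_carrier [simp]: "x \<in> carrier R \<Longrightarrow> V x \<in> carrier R"
  using V_closed by auto

lemma V_zero [simp]: "V \<zero> = \<zero>"
  using V_add[of \<zero> \<zero>] by (metis V_in_carrier add.l_cancel_one' zero_closed)

lemma V_minus: "\<lbrakk>x \<in> carrier R; y \<in> carrier R\<rbrakk> \<Longrightarrow> V (x \<ominus> y) = V x \<ominus> V y"
proof -
  assume xy: "x \<in> carrier R" "y \<in> carrier R"
  have "(x \<ominus> y) \<oplus> y = x" using xy by algebra
  then have "V x = V (x \<ominus> y) \<oplus> V y" using V_add[of "x \<ominus> y" y] xy by simp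
  moreover have "u = (u \<oplus> v) \<ominus> v" if "u \<in> carrier R" "v \<in> carrier R" for u v
    using that by algebra
  ultimately show ?thesis using xy by simp
qed

lemma V_add_pow: "x \<in> carrier R \<Longrightarrow> V ([(n::nat)] \<cdot> x) = [n] \<cdot> V x"
  by (induction n) (simp_all add: V_add)

text \<open>For \<open>p > 2\<close> the coefficient in the formula for \<open>\<delta> (V a)\<close> is a multiple of \<open>p\<close>.\<close>

lemma coeff_V_torsion:
  assumes "p > 2" "x \<in> carrier R" "[p] \<cdot> x = \<zero>"
  shows "[(p ^ (p - 2))] \<cdot> V x = \<zero>"
proof -
  have "p ^ (p - 2) = p * p ^ (p - 3)"
    using assms(1) by (metis Suc_diff_Suc numeral_2_eq_2 numeral_3_eq_3 power_Suc)
  then have "[(p ^ (p - 2))] \<cdot> V x = [(p ^ (p - 3))] \<cdot> ([p] \<cdot> V x)"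
    using assms(2) by (simp add: add.nat_pow_pow)
  also have "[p] \<cdot> V x = \<zero>"
    using assms V_add_pow[of x p] by simp
  finally show ?thesis by simp
qed

text \<open>
  By the projection formula, the square is \<open>V\<close> of a multiple of \<open>F (V x) = p x\<close>.
\<close>

lemma V_torsion_square:
  assumes "x \<in> carrier R" "[p] \<cdot> x = \<zero>"
  shows "V x [^] (2::nat) = \<zero>"
proof -
  have "V x [^] (2::nat) = V x \<otimes> V x" using assms by (simp add: numeral_2_eq_2)
  also have "\<dots> = V (delta_Frobenius p R \<delta> (V x) \<otimes> x)" using assms by (simp add: mult_V)
  also have "\<dots> = \<zero>" using assms by (simp add: Frobenius_V)
  finally show ?thesis .
qed

text \<open>
  If \<open>V a = 0\<close>, then \<open>p a = F (V a) = 0\<close> and \<open>a = p^(p-2) V (a^p)\<close> from the formula for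
  \<open>\<delta> (V a)\<close>.  For \<open>p > 2\<close> the right-hand side is visibly zero; for \<open>p = 2\<close> it shows that \<open>a\<close> is
  \<open>V\<close> of a 2-torsion element, so \<open>a^2 = 0\<close>, and feeding this back gives \<open>a = V 0\<close>.
\<close>

lemma V_eq_zero:
  assumes a: "a \<in> carrier R" and "V a = \<zero>"
  shows "a = \<zero>"
proof -
  have pa: "[p] \<cdot> a = \<zero>"
    using Frobenius_V[OF a] assms(2) prime_gt_0_nat[OF prime_p]
    by (simp add: delta_Frobenius_def delta_zero nat_pow_zero)
  have eq: "a = [(p ^ (p - 2))] \<cdot> V (a [^] p)"
    using delta_V[OF a] unfolding assms(2) delta_zero
    by (metis a V_in_carrier add.nat_pow_closed nat_pow_closed r_right_minus_eq)
  have pap: "[p] \<cdot> (a [^] p) = \<zero>"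
    using add_pow_cong_nat_pow[OF a zero_closed, of p p] pa prime_gt_0_nat[OF prime_p]
    by (simp add: nat_pow_zero)
  show ?thesis
  proof (cases "p = 2")
    case True
    have eq2: "a = V (a [^] (2::nat))" using eq a True by simp
    then have "a [^] (2::nat) = \<zero>"
      using V_torsion_square[of "a [^] (2::nat)"] pap True a by simp
    then show ?thesis using eq2 by simp
  next
    case False
    then have "p > 2" using prime_ge_2_nat[OF prime_p] by simp
    then show ?thesis using eq coeff_V_torsion[of "a [^] p"] pap a by simp
  qed
qed

lemma V_inj: "\<lbrakk>x \<in> carrier R; y \<in> carrier R; V x = V y\<rbrakk> \<Longrightarrow> x = y"
  using V_eq_zero[of "x \<ominus> y"] by (simp add: V_minus)

lemma V_fixed_eq_zero:
  assumes "V_adically_separated R V" "x \<in> carrier R" "V x = x"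
  shows "x = \<zero>"
proof -
  have "(V ^^ i) x = x" for i using assms(3) by (induction i) simp_all
  then have "x \<in> (V ^^ i) ` carrier R" for i using assms(2) by (metis imageI)
  then show ?thesis using assms(1) unfolding V_adically_separated_def by blast
qed

end

section \<open>Delta-maps preserving the ideal of Verschiebungen\<close>

text \<open>
  The map \<open>g\<close> records a choice of preimages under \<open>VB\<close>; making it a parameter lets \<open>g\<close> be
  compared with \<open>f\<close> as a map.
\<close>

locale V_ideal_map =
  A: delta_Cartier_ring p A \<delta>A VA + B: delta_Cartier_ring p B \<delta>B VB
  for p :: nat
    and A :: "('a, 'm) ring_scheme" and \<delta>A VA :: "'a \<Rightarrow> 'a"
    and B :: "('b, 'n) ring_scheme" and \<delta>B VB :: "'b \<Rightarrow> 'b" +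
  fixes f g :: "'a \<Rightarrow> 'b"
  assumes f_delta_hom: "f \<in> delta_ring_hom A \<delta>A B \<delta>B"
    and g_closed [simp]: "a \<in> carrier A \<Longrightarrow> g a \<in> carrier B"
    and f_V: "a \<in> carrier A \<Longrightarrow> f (VA a) = VB (g a)"
begin

lemma f_ring_hom: "f \<in> ring_hom A B"
  using f_delta_hom by (simp add: delta_ring_hom_def)

sublocale f: ring_hom_cring A B f
  by (simp add: ring_hom_cring_def ring_hom_cring_axioms_def A.is_cring B.is_cring f_ring_hom)

lemma f_pow: "a \<in> carrier A \<Longrightarrow> f (a [^]\<^bsub>A\<^esub> (n::nat)) = f a [^]\<^bsub>B\<^esub> n"
  by (induction n) simp_all

lemma f_delta: "a \<in> carrier A \<Longrightarrow> f (\<delta>A a) = \<delta>B (f a)"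
  using f_delta_hom by (simp add: delta_ring_hom_def)

lemma f_add_pow: "a \<in> carrier A \<Longrightarrow> f ([(n::nat)] \<cdot>\<^bsub>A\<^esub> a) = [n] \<cdot>\<^bsub>B\<^esub> f a"
  by (induction n) simp_all

lemma f_Frobenius:
  "a \<in> carrier A \<Longrightarrow> f (delta_Frobenius p A \<delta>A a) = delta_Frobenius p B \<delta>B (f a)"
  by (simp add: delta_Frobenius_def f_pow f_add_pow f_delta)

lemma g_add:
  "\<lbrakk>a \<in> carrier A; b \<in> carrier A\<rbrakk> \<Longrightarrow> g (a \<oplus>\<^bsub>A\<^esub> b) = g a \<oplus>\<^bsub>B\<^esub> g b"
  by (rule B.V_inj) (simp_all add: B.V_add A.V_add flip: f_V)

lemma g_add_pow: "a \<in> carrier A \<Longrightarrow> g ([(n::nat)] \<cdot>\<^bsub>A\<^esub> a) = [n] \<cdot>\<^bsub>B\<^esub> g a"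
  by (rule B.V_inj) (simp_all add: B.V_add_pow A.V_add_pow f_add_pow flip: f_V)

text \<open>This is \<open>f\<close> applied to the projection formula \<open>a V b = V (F a \<cdot> b)\<close>, with \<open>V\<close> cancelled.\<close>

lemma g_Frobenius_mult:
  assumes "a \<in> carrier A" "b \<in> carrier A"
  shows "g (delta_Frobenius p A \<delta>A a \<otimes>\<^bsub>A\<^esub> b) = delta_Frobenius p B \<delta>B (f a) \<otimes>\<^bsub>B\<^esub> g b"
proof (rule B.V_inj)
  have "VB (g (delta_Frobenius p A \<delta>A a \<otimes>\<^bsub>A\<^esub> b)) = f (a \<otimes>\<^bsub>A\<^esub> VA b)"
    using assms by (simp add: A.mult_V flip: f_V)
  then show "VB (g (delta_Frobenius p A \<delta>A a \<otimes>\<^bsub>A\<^esub> b)) =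
      VB (delta_Frobenius p B \<delta>B (f a) \<otimes>\<^bsub>B\<^esub> g b)"
    using assms by (simp add: f_V B.mult_V)
qed (use assms in simp_all)

text \<open>Compare \<open>F (V (g a)) = p (g a)\<close> with \<open>f (F (V a)) = p (f a)\<close>.\<close>

lemma p_times_g:
  assumes a: "a \<in> carrier A"
  shows "[p] \<cdot>\<^bsub>B\<^esub> g a = [p] \<cdot>\<^bsub>B\<^esub> f a"
proof -
  have "[p] \<cdot>\<^bsub>B\<^esub> g a = delta_Frobenius p B \<delta>B (f (VA a))"
    using a by (simp add: B.Frobenius_V f_V)
  also have "\<dots> = f ([p] \<cdot>\<^bsub>A\<^esub> a)"
    using a by (simp add: A.Frobenius_V flip: f_Frobenius)
  finally show ?thesis using a by (simp add: f_add_pow)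
qed

lemma p_times_g_power_diff:
  assumes a: "a \<in> carrier A"
  shows "[p] \<cdot>\<^bsub>B\<^esub> (g a [^]\<^bsub>B\<^esub> p \<ominus>\<^bsub>B\<^esub> g (a [^]\<^bsub>A\<^esub> p)) = \<zero>\<^bsub>B\<^esub>"
  using a p_times_g[of "a [^]\<^bsub>A\<^esub> p"] B.add_pow_cong_nat_pow[OF _ _ p_times_g[OF a], of p]
  by (simp add: f_pow B.add_pow_minus)

text \<open>Compare the two expansions of \<open>\<delta> (V (g a)) = f (\<delta> (V a))\<close>.\<close>

lemma defect_formula:
  assumes a: "a \<in> carrier A"
  shows "g a \<ominus>\<^bsub>B\<^esub> f a =
    [(p ^ (p - 2))] \<cdot>\<^bsub>B\<^esub> VB (g a [^]\<^bsub>B\<^esub> p \<ominus>\<^bsub>B\<^esub> g (a [^]\<^bsub>A\<^esub> p))"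
proof -
  define u where "u = [(p ^ (p - 2))] \<cdot>\<^bsub>B\<^esub> VB (g a [^]\<^bsub>B\<^esub> p)"
  define v where "v = [(p ^ (p - 2))] \<cdot>\<^bsub>B\<^esub> VB (g (a [^]\<^bsub>A\<^esub> p))"
  have uv: "u \<in> carrier B" "v \<in> carrier B" using a by (simp_all add: u_def v_def)
  have "g a \<ominus>\<^bsub>B\<^esub> u = \<delta>B (f (VA a))"
    using a by (simp add: B.delta_V f_V u_def)
  also have "\<dots> = f (\<delta>A (VA a))"
    using a by (simp add: f_delta)
  also have "\<dots> = f a \<ominus>\<^bsub>B\<^esub> v"
    using a by (simp add: A.delta_V A.minus_eq B.minus_eq f_add_pow f_V v_def)
  finally have eq: "g a \<ominus>\<^bsub>B\<^esub> u = f a \<ominus>\<^bsub>B\<^esub> v" .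
  have c: "g a \<in> carrier B" "f a \<in> carrier B" using a by simp_all
  have "g a \<ominus>\<^bsub>B\<^esub> f a = (g a \<ominus>\<^bsub>B\<^esub> u) \<ominus>\<^bsub>B\<^esub> (f a \<ominus>\<^bsub>B\<^esub> v) \<oplus>\<^bsub>B\<^esub> (u \<ominus>\<^bsub>B\<^esub> v)"
    using c uv by algebra
  also have "\<dots> = u \<ominus>\<^bsub>B\<^esub> v"
    using uv c by (simp add: eq)
  also have "\<dots> = [(p ^ (p - 2))] \<cdot>\<^bsub>B\<^esub> VB (g a [^]\<^bsub>B\<^esub> p \<ominus>\<^bsub>B\<^esub> g (a [^]\<^bsub>A\<^esub> p))"
    using a by (simp add: u_def v_def B.V_minus B.add_pow_minus)
  finally show ?thesis .
qed

lemma g_eq_f_odd: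
  assumes "p > 2" "a \<in> carrier A"
  shows "g a = f a"
  using defect_formula[OF assms(2)] B.coeff_V_torsion[OF assms(1) _ p_times_g_power_diff] assms
  by simp

text \<open>
  At the prime 2 the defect is \<open>V\<close> of a 2-torsion element, so it squares to zero.  Hence
  \<open>(g a)^2 = f (a^2)\<close>, and the defect formula relates the defects at \<open>a\<close> and at \<open>a^2\<close>.
\<close>

lemma defect_two_square:
  assumes p: "p = 2" and a: "a \<in> carrier A"
  shows "g a \<ominus>\<^bsub>B\<^esub> f a = VB (f (a [^]\<^bsub>A\<^esub> p) \<ominus>\<^bsub>B\<^esub> g (a [^]\<^bsub>A\<^esub> p))"
proof -
  define x where "x = g a [^]\<^bsub>B\<^esub> p \<ominus>\<^bsub>B\<^esub> g (a [^]\<^bsub>A\<^esub> p)"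
  have x: "x \<in> carrier B" using a by (simp add: x_def)
  have e: "g a \<ominus>\<^bsub>B\<^esub> f a = VB x" using defect_formula[OF a] x p by (simp add: x_def)
  have "[p] \<cdot>\<^bsub>B\<^esub> x = \<zero>\<^bsub>B\<^esub>" using p_times_g_power_diff[OF a] by (simp add: x_def)
  then have "(g a \<ominus>\<^bsub>B\<^esub> f a) [^]\<^bsub>B\<^esub> (2::nat) = \<zero>\<^bsub>B\<^esub>"
    using B.V_torsion_square[OF x] e by simp
  moreover have "[(2::nat)] \<cdot>\<^bsub>B\<^esub> (g a \<ominus>\<^bsub>B\<^esub> f a) = \<zero>\<^bsub>B\<^esub>"
    using p_times_g[OF a] p a by (simp add: B.add_pow_minus)
  ultimately have "g a [^]\<^bsub>B\<^esub> p = f a [^]\<^bsub>B\<^esub> p"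
    using B.square_eq_if_diff_square_zero a p by simp
  then show ?thesis using e a by (simp add: f_pow x_def)
qed

text \<open>
  Up to a multiple of \<open>p\<close>, on which \<open>f\<close> and \<open>g\<close> agree, \<open>a^p\<close> is \<open>F a\<close>, and the
  semilinearity of \<open>g\<close> reduces the defect at \<open>F a\<close> to the defect at 1.
\<close>

lemma defect_p_power:
  assumes a: "a \<in> carrier A"
  shows "f (a [^]\<^bsub>A\<^esub> p) \<ominus>\<^bsub>B\<^esub> g (a [^]\<^bsub>A\<^esub> p) =
    delta_Frobenius p B \<delta>B (f a) \<otimes>\<^bsub>B\<^esub> (\<one>\<^bsub>B\<^esub> \<ominus>\<^bsub>B\<^esub> g \<one>\<^bsub>A\<^esub>)"
proof -
  define F where "F = delta_Frobenius p B \<delta>B (f a)"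
  define d where "d = [p] \<cdot>\<^bsub>B\<^esub> f (\<delta>A a)"
  have c: "F \<in> carrier B" "d \<in> carrier B" "f (a [^]\<^bsub>A\<^esub> p) \<in> carrier B"
    "g (a [^]\<^bsub>A\<^esub> p) \<in> carrier B" "g \<one>\<^bsub>A\<^esub> \<in> carrier B"
    using a by (simp_all add: F_def d_def)
  have "F \<otimes>\<^bsub>B\<^esub> g \<one>\<^bsub>A\<^esub> = g (delta_Frobenius p A \<delta>A a)"
    using g_Frobenius_mult[of a "\<one>\<^bsub>A\<^esub>"] a by (simp add: F_def)
  also have "\<dots> = g (a [^]\<^bsub>A\<^esub> p) \<oplus>\<^bsub>B\<^esub> d"
    using a by (simp add: delta_Frobenius_def g_add g_add_pow p_times_g d_def)
  finally have g1: "F \<otimes>\<^bsub>B\<^esub> g \<one>\<^bsub>A\<^esub> = g (a [^]\<^bsub>A\<^esub> p) \<oplus>\<^bsub>B\<^esub> d" .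
  have f1: "F = f (a [^]\<^bsub>A\<^esub> p) \<oplus>\<^bsub>B\<^esub> d"
    using a by (simp add: F_def d_def delta_Frobenius_def f_pow f_delta)
  have "F \<otimes>\<^bsub>B\<^esub> (\<one>\<^bsub>B\<^esub> \<ominus>\<^bsub>B\<^esub> g \<one>\<^bsub>A\<^esub>) = F \<ominus>\<^bsub>B\<^esub> F \<otimes>\<^bsub>B\<^esub> g \<one>\<^bsub>A\<^esub>"
    using c by algebra
  also have "\<dots> = (f (a [^]\<^bsub>A\<^esub> p) \<oplus>\<^bsub>B\<^esub> d) \<ominus>\<^bsub>B\<^esub> (g (a [^]\<^bsub>A\<^esub> p) \<oplus>\<^bsub>B\<^esub> d)"
    unfolding g1 by (simp only: f1)
  also have "\<dots> = f (a [^]\<^bsub>A\<^esub> p) \<ominus>\<^bsub>B\<^esub> g (a [^]\<^bsub>A\<^esub> p)"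
    using c(2-4) by algebra
  finally show ?thesis by (simp add: F_def)
qed

lemma defect_two:
  assumes "p = 2" and a: "a \<in> carrier A"
  shows "g a \<ominus>\<^bsub>B\<^esub> f a = f a \<otimes>\<^bsub>B\<^esub> VB (\<one>\<^bsub>B\<^esub> \<ominus>\<^bsub>B\<^esub> g \<one>\<^bsub>A\<^esub>)"
  using defect_two_square[OF assms] defect_p_power[OF a] a by (simp add: B.mult_V)

lemma g_eq_f_two:
  assumes p: "p = 2" and a: "a \<in> carrier A"
    and "f (VA \<one>\<^bsub>A\<^esub>) = VB \<one>\<^bsub>B\<^esub> \<or> V_adically_separated B VB"
  shows "g a = f a"
proof -
  define d where "d = \<one>\<^bsub>B\<^esub> \<ominus>\<^bsub>B\<^esub> g \<one>\<^bsub>A\<^esub>"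
  have d: "d \<in> carrier B" by (simp add: d_def)
  have "d = \<zero>\<^bsub>B\<^esub>"
    using assms(3)
  proof
    assume "f (VA \<one>\<^bsub>A\<^esub>) = VB \<one>\<^bsub>B\<^esub>"
    then have "g \<one>\<^bsub>A\<^esub> = \<one>\<^bsub>B\<^esub>" by (simp add: B.V_inj f_V)
    then show ?thesis by (simp add: d_def)
  next
    assume sep: "V_adically_separated B VB"
    \<comment> \<open>\<open>V d = - d\<close>, and signs do not matter because \<open>2 d = 0\<close>.\<close>
    have "VB d = g \<one>\<^bsub>A\<^esub> \<ominus>\<^bsub>B\<^esub> \<one>\<^bsub>B\<^esub>"
      using defect_two[OF p, of "\<one>\<^bsub>A\<^esub>"] d by (simp add: d_def)
    also have "\<dots> = \<ominus>\<^bsub>B\<^esub> d"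
      unfolding d_def using g_closed[OF A.one_closed] B.one_closed by algebra
    also have "\<dots> = d"
    proof -
      have "[p] \<cdot>\<^bsub>B\<^esub> d = \<zero>\<^bsub>B\<^esub>"
        unfolding d_def using p_times_g[of "\<one>\<^bsub>A\<^esub>"] by (simp add: B.add_pow_minus)
      then have "d \<oplus>\<^bsub>B\<^esub> d = \<zero>\<^bsub>B\<^esub>" using d p by (simp add: numeral_2_eq_2)
      then show ?thesis using d by (simp add: B.minus_equality)
    qed
    finally show ?thesis using B.V_fixed_eq_zero[OF sep d] by simp
  qed
  then have "g a \<ominus>\<^bsub>B\<^esub> f a = \<zero>\<^bsub>B\<^esub>" using defect_two[OF p a, folded d_def] a by simp
  then show ?thesis using a by simp
qed

lemma f_delta_Cartier_ring_hom:
  assumes "\<And>a. a \<in> carrier A \<Longrightarrow> g a = f a"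
  shows "f \<in> delta_Cartier_ring_hom A \<delta>A VA B \<delta>B VB"
  using assms f_delta_hom f_V by (simp add: delta_Cartier_ring_hom_def)

end

theorem theorem5p21:
  fixes p :: nat
    and A :: "('a, 'm) ring_scheme" and \<delta>A VA :: "'a \<Rightarrow> 'a"
    and B :: "('b, 'n) ring_scheme" and \<delta>B VB :: "'b \<Rightarrow> 'b"
    and f :: "'a \<Rightarrow> 'b"
  assumes "prime p"
    and "delta_Cartier_ring p A \<delta>A VA"
    and "delta_Cartier_ring p B \<delta>B VB"
    and "f \<in> delta_ring_hom A \<delta>A B \<delta>B"
    and "f ` (VA ` carrier A) \<subseteq> VB ` carrier B"
  shows "(p > 2 \<longrightarrow> f \<in> delta_Cartier_ring_hom A \<delta>A VA B \<delta>B VB) \<and>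
    (p = 2 \<and> (f (VA \<one>\<^bsub>A\<^esub>) = VB \<one>\<^bsub>B\<^esub> \<or> V_adically_separated B VB) \<longrightarrow>
      f \<in> delta_Cartier_ring_hom A \<delta>A VA B \<delta>B VB)"
proof -
  have "\<forall>a\<in>carrier A. \<exists>b\<in>carrier B. f (VA a) = VB b"
    using assms(5) by blast
  then obtain g where "\<forall>a\<in>carrier A. g a \<in> carrier B \<and> f (VA a) = VB (g a)"
    by metis
  then interpret V_ideal_map p A \<delta>A VA B \<delta>B VB f g
    using assms(2-4) by (simp add: V_ideal_map_def V_ideal_map_axioms_def)
  show ?thesis
    using f_delta_Cartier_ring_hom g_eq_f_odd g_eq_f_two by blast
qed

end
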